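(* For all integers $k \geq s \geq 3$ there exists $c = c(s,k)$ such that for all integers $d \geq 2s$, \[\xi_k(K(d,s),\mathbb{R}) \geq \frac{k - \lceil \frac{k+1}{s}\rceil + 1}{s-1}\cdot d - c.\]
   Context: For integers $d \geq 2s$, the Kneser graph $K(d,s)$ has as vertices all $s$-subsets of $[d]=\{1,\ldots,d\}$, two sets being adjacent if they are disjoint. A $t$-dimensional orthogonal $k$-subspace representation of a graph $G=(V,E)$ is an assignment of a linear subspace $U_v \subseteq \mathbb{R}^t$ with $\dim(U_v)=k$ to every vertex $v$, such that $U_v$ and $U_{v'}$ are orthogonal subspaces (with respect to the standard inner product) whenever $v,v'$ are adjacent. $\xi_k(G,\mathbb{R})$ denotes the smallest integer $t$ for which such a representation exists. *)

theory Defs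
  imports Complex_Main "Graph_Theory.Pair_Digraph" "Jordan_Normal_Form.DL_Rank"
begin

text \<open>
  Simple graphs are rendered as in the Graph Theory entry of the AFP: an undirected edge is
  a symmetric pair of arcs, and a finite simple graph is a \<open>pair_graph\<close>.
\<close>

definition kneser_graph :: "nat \<Rightarrow> nat \<Rightarrow> nat set pair_pre_digraph" where
  "kneser_graph d s =
    \<lparr> pverts = {A. A \<subseteq> {1..d} \<and> card A = s},
      parcs = {(A, B). A \<subseteq> {1..d} \<and> card A = s \<and> B \<subseteq> {1..d} \<and> card B = s
                        \<and> A \<inter> B = {}} \<rparr>"

text \<open>
  The space \<open>\<real>\<^sup>t\<close> is \<open>module_vec TYPE(real) t\<close>, with carrier \<open>carrier_vec t\<close>; the dimension of
  a subspace \<open>W\<close> is that of the vector space obtained by restricting the carrier to \<open>W\<close>.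
\<close>

definition real_subspace :: "nat \<Rightarrow> real vec set \<Rightarrow> bool" where
  "real_subspace t W \<longleftrightarrow> VectorSpace.subspace class_ring W (module_vec TYPE(real) t)"

definition real_subspace_dim :: "nat \<Rightarrow> real vec set \<Rightarrow> nat" where
  "real_subspace_dim t W = vectorspace.dim class_ring ((module_vec TYPE(real) t)\<lparr>carrier := W\<rparr>)"

definition orthogonal_subspaces :: "real vec set \<Rightarrow> real vec set \<Rightarrow> bool" where
  "orthogonal_subspaces W W' \<longleftrightarrow> (\<forall>x\<in>W. \<forall>y\<in>W'. x \<bullet> y = 0)"

definition orthogonal_subspace_rep ::
    "nat \<Rightarrow> nat \<Rightarrow> 'a pair_pre_digraph \<Rightarrow> ('a \<Rightarrow> real vec set) \<Rightarrow> bool" where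
  "orthogonal_subspace_rep t k G U \<longleftrightarrow>
    (\<forall>v \<in> pverts G. real_subspace t (U v) \<and> real_subspace_dim t (U v) = k) \<and>
    (\<forall>v w. (v, w) \<in> parcs G \<longrightarrow> orthogonal_subspaces (U v) (U w))"

text \<open>
  For finite simple graphs the least \<open>t\<close> below exists, see \<open>orthogonal_subspace_rep_exists\<close>.
\<close>

definition orth_dim :: "nat \<Rightarrow> 'a pair_pre_digraph \<Rightarrow> nat" where
  "orth_dim k G = (LEAST t. \<exists>U. orthogonal_subspace_rep t k G U)"

lemma pair_graph_kneser_graph:
  assumes "s \<ge> 1"
  shows "pair_graph (kneser_graph d s)"
proof -
  define S where "S = {A. A \<subseteq> {1..d} \<and> card A = s}"
  have verts: "pverts (kneser_graph d s) = S"
    unfolding S_def kneser_graph_def by simp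
  have arcs: "parcs (kneser_graph d s) = {(A, B). A \<in> S \<and> B \<in> S \<and> A \<inter> B = {}}"
    unfolding S_def kneser_graph_def by simp
  have fin: "finite S"
    unfolding S_def by (rule finite_subset[of _ "Pow {1..d}"]) auto
  have fin_arcs: "finite {(A, B). A \<in> S \<and> B \<in> S \<and> A \<inter> B = {}}"
    by (rule finite_subset[OF _ finite_cartesian_product[OF fin fin]]) blast
  have nonempty: "A \<noteq> {}" if "A \<in> S" for A
    using that assms by (auto simp: S_def)
  have sym: "sym {(A, B). A \<in> S \<and> B \<in> S \<and> A \<inter> B = {}}"
    by (rule symI) blast
  show ?thesis
  proof unfold_locales
    show "finite (pverts (kneser_graph d s))"
      unfolding verts by (rule fin)
    show "finite (parcs (kneser_graph d s))"
      unfolding arcs by (rule fin_arcs)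
    show "symmetric (with_proj (kneser_graph d s))"
      unfolding symmetric_def with_proj_simps arcs by (rule sym)
  next
    fix e assume "e \<in> parcs (kneser_graph d s)"
    then obtain A B where e: "e = (A, B)" "A \<in> S" "B \<in> S" "A \<inter> B = {}"
      unfolding arcs by blast
    then show "fst e \<in> pverts (kneser_graph d s)" "snd e \<in> pverts (kneser_graph d s)"
      unfolding verts by simp_all
    show "fst e \<noteq> snd e"
      using e nonempty[OF e(2)] by auto
  qed
qed

lemma orthogonal_subspaces_span:
  assumes "A \<subseteq> carrier_vec t" "B \<subseteq> carrier_vec t"
    and orth: "\<And>a b. a \<in> A \<Longrightarrow> b \<in> B \<Longrightarrow> a \<bullet> b = (0::real)"
  shows "orthogonal_subspaces (LinearCombinations.module.span class_ring (module_vec TYPE(real) t) A)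
           (LinearCombinations.module.span class_ring (module_vec TYPE(real) t) B)"
proof -
  interpret V: vec_space "TYPE(real)" t .
  have left: "x \<bullet> y = 0"
    if C: "C \<subseteq> carrier_vec t" and x: "x \<in> V.span C" and y: "y \<in> carrier_vec t"
      and z: "\<And>c. c \<in> C \<Longrightarrow> c \<bullet> y = 0" for C x and y :: "real vec"
  proof -
    from x obtain a D where D: "finite D" "D \<subseteq> C" "x = V.lincomb a D"
      unfolding V.span_def by blast
    have f: "(\<lambda>v. a v \<cdot>\<^sub>v v) \<in> D \<rightarrow> carrier_vec t"
      using D C by auto
    have "x \<bullet> y = (\<Sum>v\<in>D. (a v \<cdot>\<^sub>v v) \<bullet> y)"
      unfolding D(3) V.lincomb_def
      using y by (rule V.finsum_scalar_prod_sum[OF f])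
    also have "\<dots> = 0"
    proof (intro sum.neutral ballI)
      fix v assume "v \<in> D"
      then have v: "v \<in> C" using D(2) by (rule rev_subsetD)
      then have "v \<in> carrier_vec t" using C by (rule rev_subsetD)
      then show "(a v \<cdot>\<^sub>v v) \<bullet> y = 0"
        using y z[OF v] by simp
    qed
    finally show ?thesis .
  qed
  show ?thesis
    unfolding orthogonal_subspaces_def
  proof (intro ballI)
    fix x y
    assume x: "x \<in> V.span A" and y: "y \<in> V.span B"
    have yc: "y \<in> carrier_vec t"
      using V.span_closed[of B y] y assms(2) by simp
    have "a \<bullet> y = 0" if a: "a \<in> A" for a
    proof -
      have ac: "a \<in> carrier_vec t" using a assms(1) by (rule rev_subsetD)
      have "c \<bullet> a = 0" if c: "c \<in> B" for c
      proof -
        have "c \<in> carrier_vec t" using c assms(2) by (rule rev_subsetD)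
        then have "c \<bullet> a = a \<bullet> c" using ac by (rule comm_scalar_prod)
        also have "\<dots> = 0" using a c by (rule orth)
        finally show ?thesis .
      qed
      then have "y \<bullet> a = 0" by (rule left[OF assms(2) y ac])
      moreover have "a \<bullet> y = y \<bullet> a" using ac yc by (rule comm_scalar_prod)
      ultimately show ?thesis by simp
    qed
    then show "x \<bullet> y = 0" by (rule left[OF assms(1) x yc])
  qed
qed

lemma orthogonal_subspace_rep_exists:
  assumes "pair_graph G"
  shows "\<exists>t U. orthogonal_subspace_rep t k G U"
proof -
  interpret pair_graph G by fact
  obtain f :: "'a \<Rightarrow> nat" where f: "inj_on f (pverts G)" "f ` pverts G = {0..<card (pverts G)}"
    using ex_bij_betw_finite_nat[OF pair_finite_verts] by (auto simp: bij_betw_def)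
  define t where "t = k * card (pverts G)"
  interpret V: vec_space "TYPE(real)" t .
  define I where "I v = {k * f v..<k * f v + k}" for v
  define U where "U v = V.span (unit_vec t ` I v)" for v
  have I: "I v \<subseteq> {0..<t}" if "v \<in> pverts G" for v
  proof -
    have "f v < card (pverts G)" using f that by force
    then have "k * Suc (f v) \<le> t" unfolding t_def by (intro mult_le_mono) auto
    then show ?thesis by (auto simp: I_def)
  qed
  have disj: "I v \<inter> I w = {}" if "v \<in> pverts G" "w \<in> pverts G" "v \<noteq> w" for v w
  proof (rule ccontr)
    assume "I v \<inter> I w \<noteq> {}"
    then obtain i where i: "i \<in> I v" "i \<in> I w" by blast
    have "i div k = f v" "i div k = f w"
      using i by (auto simp: I_def intro!: div_nat_eqI simp: algebra_simps)
    with f(1) that show False by (auto simp: inj_on_def)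
  qed
  have inj: "inj_on (unit_vec t :: nat \<Rightarrow> real vec) {0..<t}"
    by (auto simp: inj_on_def)
  have sub: "(unit_vec t ` J :: real vec set) \<subseteq> carrier_vec t" for J by auto
  have "orthogonal_subspace_rep t k G U"
    unfolding orthogonal_subspace_rep_def
  proof (intro conjI ballI allI impI)
    fix v assume v: "v \<in> pverts G"
    show "real_subspace t (U v)"
      unfolding real_subspace_def U_def using sub by (intro V.span_is_subspace) auto
    have "V.lin_indpt (set (unit_vecs t))"
      using V.unit_vecs_basis by (auto simp: V.basis_def)
    moreover have "unit_vec t ` I v \<subseteq> set (unit_vecs t :: real vec list)"
      using I[OF v] by (auto simp: unit_vecs_def)
    ultimately have li: "V.lin_indpt (unit_vec t ` I v)"
      by (rule V.subset_li_is_li)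
    have "vectorspace.dim class_ring (V.span_vs (unit_vec t ` I v)) = card (unit_vec t ` I v :: real vec set)"
      using sub li
      by (intro V.dim_span) (simp_all add: I_def maximal_def subset_antisym)
    also have "\<dots> = k"
      using inj_on_subset[OF inj I[OF v]] by (simp add: card_image I_def)
    finally show "real_subspace_dim t (U v) = k"
      by (simp add: real_subspace_dim_def U_def)
  next
    fix v w assume vw: "(v, w) \<in> parcs G"
    then have "I v \<inter> I w = {}"
      using disj in_arcsD1 in_arcsD2 no_loops' by metis
    then show "orthogonal_subspaces (U v) (U w)"
      unfolding U_def using I[OF in_arcsD1[OF vw]] I[OF in_arcsD2[OF vw]]
      by (intro orthogonal_subspaces_span) (auto simp: scalar_prod_left_unit subset_iff)
  qed
  then show ?thesis by blast
qed

end

theory Submission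
  imports Defs "HOL-Library.Function_Algebras" "HOL-Library.Disjoint_Sets"
begin

text \<open>
  Put \<open>q = \<lceil>(k + 1) / s\<rceil>\<close>, \<open>a = k + 1 - q\<close> and \<open>r = s - 1\<close>, so that \<open>a \<le> r q\<close> and the slope is
  \<open>a / r\<close>. Move the points of \<open>[d]\<close> one by one into a set \<open>F\<close> while building a span \<open>H\<close> of pieces of
  the spaces \<open>U\<^sub>B\<close>, and cut \<open>F\<close> into disjoint blocks of size \<open>r\<close>. If some \<open>z \<notin> F\<close> and some block \<open>A\<close>
  make \<open>U\<^bsub>A \<union> {z}\<^esub>\<close> contribute at least \<open>q\<close> new dimensions to \<open>H\<close>, add them, at the cost of the
  single point \<open>z\<close>. Otherwise \<open>U\<^bsub>A \<union> {z}\<^esub> \<inter> H\<close> has dimension at least \<open>a\<close> for all \<open>A\<close> and \<open>z\<close>.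
  Every generator of \<open>H\<close> comes from a set \<open>P \<union> {y}\<close> that meets only \<open>P\<close> and the block of \<open>y\<close>; the
  resulting graph on blocks is \<open>r\<close>-degenerate, so \<open>s\<close> colours suffice to separate \<open>P\<close> from the block
  of \<open>y\<close>. Choosing a different \<open>z\<close> for each colour makes the intersections
  \<open>U\<^bsub>A \<union> {z}\<^esub> \<inter> H\<close> linearly independent, whence \<open>dim H \<ge> a |F| / r - O(1)\<close> outright, and any
  point may be moved into \<open>F\<close> for free.
\<close>

section \<open>Dimension counting in an abstract vector space\<close>

context vector_space
begin

text \<open>Extending \<open>S\<close> by vectors of \<open>W\<close> to span \<open>S\<close> and
  \<open>W\<close> adds a set \<open>C\<close>, and \<open>W\<close> is spanned by \<open>C\<close>
  together with a basis of \<open>W \<inter> span S\<close>. Since \<open>W\<close> has at least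
  \<open>a + q - 1\<close> independent vectors, fewer than \<open>q\<close> vectors in
  \<open>C\<close> leave at least \<open>a\<close> for the intersection.\<close>

lemma extend_independent_or_meet_span:
  assumes S: "finite S" "independent S" and W: "subspace W"
    and B: "B \<subseteq> W" "independent B" "finite B" and W_fin: "W \<subseteq> span T" "finite T"
    and aq: "a + q \<le> card B + 1"
  obtains (extend) C where "C \<subseteq> W" "finite C" "C \<inter> S = {}" "independent (S \<union> C)" "card C = q"
    | (meet) D where "D \<subseteq> W \<inter> span S" "finite D" "independent D" "card D = a"
proof -
  obtain B' where B': "S \<subseteq> B'" "B' \<subseteq> S \<union> W" "independent B'" "S \<union> W \<subseteq> span B'"
    using maximal_independent_subset_extend[of S "S \<union> W"] S by blast
  have "B' \<subseteq> span (S \<union> T)"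
    using B'(2) W_fin(1) span_superset[of S] span_mono[of S "S \<union> T"] span_mono[of T "S \<union> T"] by blast
  then have "finite B'"
    using independent_span_bound[of "S \<union> T" B'] S W_fin B'(3) by blast
  define C where "C = B' - S"
  have C: "C \<subseteq> W" "finite C" "S \<inter> C = {}" "B' = S \<union> C"
    using B' \<open>finite B'\<close> by (auto simp: C_def)
  show thesis
  proof (cases "q \<le> card C")
    case True
    then obtain C' where "C' \<subseteq> C" "card C' = q" "finite C'"
      using obtain_subset_with_card_n by metis
    moreover have "independent (S \<union> C')"
      using C(4) \<open>C' \<subseteq> C\<close> by (intro independent_mono[OF B'(3)]) auto
    ultimately show thesis
      using C by (intro extend[of C']) auto
  next
    case False
    obtain D where D: "D \<subseteq> W \<inter> span S" "independent D" "W \<inter> span S \<subseteq> span D"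
      using maximal_independent_subset[of "W \<inter> span S"] by blast
    have "finite D"
      using independent_span_bound[OF S(1) D(2)] D(1) by blast
    \<comment> \<open>Modular law: \<open>C\<close> lies in \<open>W\<close>, so the
      \<open>span S\<close> component of a vector of \<open>W\<close> lies in \<open>W\<close>
      too.\<close>
    have "W \<subseteq> span (D \<union> C)"
    proof
      fix w assume "w \<in> W"
      then have "w \<in> span (S \<union> C)" using B'(4) C(4) by blast
      then obtain h c where hc: "h \<in> span S" "c \<in> span C" "w = h + c"
        unfolding span_Un by blast
      have "c \<in> W" using span_minimal[OF C(1) W] hc(2) by blast
      then have "h \<in> W" using subspace_diff[OF W \<open>w \<in> W\<close>] hc(3) by (metis add_diff_cancel_right')
      then have "h \<in> span D" using D(3) hc(1) by blast
      then show "w \<in> span (D \<union> C)"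
        unfolding span_Un using hc by blast
    qed
    then have "card B \<le> card (D \<union> C)"
      using independent_span_bound[of "D \<union> C" B] B \<open>finite D\<close> C(2) by auto
    also have "\<dots> \<le> card D + card C" by (rule card_Un_le)
    finally have "a \<le> card D" using aq False by simp
    then obtain D' where "D' \<subseteq> D" "card D' = a" "finite D'"
      using obtain_subset_with_card_n by metis
    then show thesis
      using D independent_mono by (intro meet[of D']) auto
  qed
qed

text \<open>The assumption \<open>zero\<close> makes the sum of the spans direct, so the union of
  the bases is disjoint and independent inside \<open>span S\<close>.\<close>

lemma independent_family_card_le:
  assumes I: "finite I" and S: "finite S"
    and K: "\<And>i. i \<in> I \<Longrightarrow> K i \<subseteq> span S" "\<And>i. i \<in> I \<Longrightarrow> independent (K i)"
      "\<And>i. i \<in> I \<Longrightarrow> card (K i) = a"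
    and zero: "\<And>x i. (\<And>j. j \<in> I \<Longrightarrow> x j \<in> span (K j)) \<Longrightarrow> sum x I = 0 \<Longrightarrow> i \<in> I \<Longrightarrow> x i = 0"
  shows "a * card I \<le> card S"
proof -
  have fin: "finite (K i)" if "i \<in> I" for i
    using independent_span_bound[OF S K(2)[OF that] K(1)[OF that]] by blast
  have disj: "K i \<inter> K j = {}" if ij: "i \<in> I" "j \<in> I" "i \<noteq> j" for i j
  proof (rule ccontr)
    assume "K i \<inter> K j \<noteq> {}"
    then obtain v where v: "v \<in> K i" "v \<in> K j" by blast
    \<comment> \<open>A vector common to two bases would give the nontrivial relation
      \<open>v + (- v) = 0\<close> between their spans.\<close>
    define x where "x = (\<lambda>_. 0)(i := v, j := - v)"
    have "sum x I = sum x {i, j}"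
      using I ij by (intro sum.mono_neutral_right) (auto simp: x_def)
    also have "\<dots> = 0" using ij by (simp add: x_def)
    finally have "x i = 0"
      by (rule zero[rotated]) (use v ij in \<open>auto simp: x_def span_base span_neg span_zero\<close>)
    then have "v = 0" using ij by (simp add: x_def)
    then show False using v K(2) ij dependent_zero by blast
  qed
  have "independent (\<Union>i\<in>I. K i)"
  proof (rule independent_if_scalars_zero)
    show "finite (\<Union>i\<in>I. K i)" using I fin by blast
  next
    fix f v assume sum0: "(\<Sum>v\<in>(\<Union>i\<in>I. K i). f v *s v) = 0" and "v \<in> (\<Union>i\<in>I. K i)"
    then obtain i where i: "i \<in> I" "v \<in> K i" by blast
    have "(\<Sum>i\<in>I. \<Sum>v\<in>K i. f v *s v) = 0"
      using sum0 I fin disj by (subst (asm) sum.UNION_disjoint) auto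
    then have "(\<Sum>v\<in>K i. f v *s v) = 0"
      by (rule zero[where x = "\<lambda>i. \<Sum>v\<in>K i. f v *s v", rotated])
        (use i in \<open>auto intro!: span_sum span_scale intro: span_base\<close>)
    then show "f v = 0"
      using independentD[OF K(2)[OF i(1)] fin[OF i(1)] order_refl] i(2) by blast
  qed
  then have "card (\<Union>i\<in>I. K i) \<le> card S"
    using independent_span_bound[OF S] K(1) by blast
  moreover have "card (\<Union>i\<in>I. K i) = (\<Sum>i\<in>I. card (K i))"
    using I fin disj by (intro card_UN_disjoint) auto
  ultimately show ?thesis using K(3) by (simp add: mult.commute)
qed

end

section \<open>Symmetric bilinear forms without isotropic vectors\<close>

text \<open>Anisotropy stands in for positive definiteness. It is required only on \<open>C\<close>
  because the form used later, \<open>dot_upto t\<close>, vanishes on functions that live at indices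
  \<open>t\<close> and above.\<close>

locale anisotropic_space = vector_space scale
  for scale :: "'a::field \<Rightarrow> 'v::ab_group_add \<Rightarrow> 'v" (infixr \<open>*s\<close> 75) +
  fixes ip :: "'v \<Rightarrow> 'v \<Rightarrow> 'a" and C :: "'v set"
  assumes ip_add_left: "ip (x + y) z = ip x z + ip y z"
    and ip_scale_left: "ip (c *s x) z = c * ip x z"
    and ip_commute: "ip x y = ip y x"
    and subspace_C: "subspace C"
    and anisotropic: "x \<in> C \<Longrightarrow> ip x x = 0 \<Longrightarrow> x = 0"
begin

lemma ip_zero_left [simp]: "ip 0 z = 0"
  using ip_scale_left[of 0 0 z] by simp

lemma ip_sum_left: "ip (sum f A) z = (\<Sum>i\<in>A. ip (f i) z)"
  by (induction A rule: infinite_finite_induct) (simp_all add: ip_add_left)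

lemma ip_sum_right: "ip z (sum f A) = (\<Sum>i\<in>A. ip z (f i))"
  by (simp add: ip_commute[of z] ip_sum_left)

lemma orthogonal_span_right:
  assumes "\<And>v. v \<in> S \<Longrightarrow> ip x v = 0" and "y \<in> span S"
  shows "ip x y = 0"
  using assms(2)
proof (induction rule: span_induct_alt)
  case base
  then show ?case by (simp add: ip_commute[of x])
next
  case (step c v y)
  then show ?case
    using assms(1) by (simp add: ip_commute[of x] ip_add_left ip_scale_left)
qed

end

section \<open>Growing an independent set from a Kneser representation\<close>

text \<open>Vertices are the \<open>Suc r\<close>-subsets of \<open>X\<close>. With
  \<open>a + q = k + 1\<close>, the inequality in \<open>dim_U\<close> says that every space has
  dimension at least \<open>k\<close>.\<close>

locale kneser_rep = anisotropic_space scale ip C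
  for scale :: "'a::field \<Rightarrow> 'v::ab_group_add \<Rightarrow> 'v" (infixr \<open>*s\<close> 75) and ip C +
  fixes X :: "'e set" and U :: "'e set \<Rightarrow> 'v set" and r a q :: nat
  assumes finite_X: "finite X"
    and r_pos: "r > 0"
    and a_le: "a \<le> r * q"
    and subspace_U: "A \<subseteq> X \<Longrightarrow> card A = Suc r \<Longrightarrow> subspace (U A)"
    and U_subset_C: "A \<subseteq> X \<Longrightarrow> card A = Suc r \<Longrightarrow> U A \<subseteq> C"
    and fin_dim_U: "A \<subseteq> X \<Longrightarrow> card A = Suc r \<Longrightarrow> \<exists>T. finite T \<and> U A \<subseteq> span T"
    and dim_U: "A \<subseteq> X \<Longrightarrow> card A = Suc r \<Longrightarrow>
      \<exists>B \<subseteq> U A. finite B \<and> independent B \<and> a + q \<le> card B + 1"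
    and orth_U: "A \<subseteq> X \<Longrightarrow> card A = Suc r \<Longrightarrow> B \<subseteq> X \<Longrightarrow> card B = Suc r \<Longrightarrow> A \<inter> B = {} \<Longrightarrow>
      x \<in> U A \<Longrightarrow> y \<in> U B \<Longrightarrow> ip x y = 0"
begin

text \<open>
  \<open>P\<close> is the set of blocks, \<open>S\<close> is a basis of \<open>H\<close>, and \<open>par y = Some A\<close> records that the dimensions
  gained when \<open>y\<close> was moved into \<open>F\<close> come from \<open>U (insert y A)\<close>.
\<close>

definition state ::
    "'e set \<Rightarrow> 'e set set \<Rightarrow> ('e set \<Rightarrow> nat) \<Rightarrow> ('e \<Rightarrow> 'e set option) \<Rightarrow> 'v set \<Rightarrow> bool" where
  "state F P colour par S \<longleftrightarrow>
    F \<subseteq> X \<and> (\<forall>A\<in>P. A \<subseteq> F \<and> card A = r \<and> colour A \<le> r) \<and> disjoint P \<and>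
    (\<forall>y A. par y = Some A \<longrightarrow> y \<in> F \<and> A \<in> P \<and> y \<notin> A) \<and>
    (\<forall>A\<in>P. \<forall>y\<in>A. \<forall>B. par y = Some B \<longrightarrow> colour A \<noteq> colour B) \<and>
    finite S \<and> independent S \<and> (\<forall>v\<in>S. \<exists>y A. par y = Some A \<and> v \<in> U (insert y A)) \<and>
    a * card F \<le> r * card S + a * r"

lemma state_finite:
  assumes "state F P colour par S"
  shows "finite F"
  using assms finite_subset[OF _ finite_X] by (simp add: state_def)

lemma state_par:
  assumes "state F P colour par S" "par y = Some A"
  shows "y \<in> F" "A \<in> P" "y \<notin> A"
  using assms by (simp_all add: state_def)

lemma state_generated:
  assumes "state F P colour par S" "v \<in> S"
  obtains y A where "par y = Some A" "v \<in> U (insert y A)"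
  using assms unfolding state_def by metis

lemma vertex_insert:
  assumes "state F P colour par S" "A \<in> P" "z \<in> X" "z \<notin> A"
  shows "insert z A \<subseteq> X" "card (insert z A) = Suc r"
proof -
  have A: "A \<subseteq> X" "card A = r" using assms by (auto simp: state_def)
  then show "insert z A \<subseteq> X" using assms by auto
  have "finite A" using finite_subset[OF A(1) finite_X] .
  then show "card (insert z A) = Suc r" using A assms by simp
qed

text \<open>The new block has to avoid the colours of the parents of its \<open>r\<close> points,
  and \<open>r + 1\<close> colours are available. No older block is affected, since \<open>A\<close>
  is not yet the parent of any point.\<close>

lemma state_add_block:
  assumes st: "state F P colour par S" and A: "A \<subseteq> F - \<Union>P" "card A = r"
  shows "\<exists>colour'. state F (insert A P) colour' par S"
proof -
  have "finite A" using finite_subset[OF _ state_finite[OF st], of A] A(1) by blast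
  \<comment> \<open>A point with \<open>par y = None\<close> contributes an unspecified colour. This
    can only enlarge the forbidden set, which still has at most \<open>r\<close> elements.\<close>
  define N where "N = (\<lambda>y. colour (the (par y))) ` A"
  have "card N < card {..r}"
    using card_image_le[OF \<open>finite A\<close>, of "\<lambda>y. colour (the (par y))"] A(2) by (simp add: N_def)
  then have "\<not> {..r} \<subseteq> N"
    using card_mono[of N "{..r}"] \<open>finite A\<close> by (auto simp: N_def)
  then obtain c where c: "c \<le> r" "c \<notin> N" by auto
  have ne: "A \<noteq> {}" using A(2) r_pos by auto
  then have "A \<notin> P" using A(1) by auto
  have "state F (insert A P) (colour(A := c)) par S"
    unfolding state_def
  proof (intro conjI)
    show "\<forall>B\<in>insert A P. \<forall>y\<in>B. \<forall>B'. par y = Some B' \<longrightarrow> (colour(A := c)) B \<noteq> (colour(A := c)) B'"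
    proof (intro ballI allI impI)
      fix B y B' assume B: "B \<in> insert A P" "y \<in> B" "par y = Some B'"
      then have "B' \<in> P" using st by (simp add: state_def)
      then have "B' \<noteq> A" using \<open>A \<notin> P\<close> by blast
      moreover have "colour B' \<in> N" if "y \<in> A"
        using that B(3) unfolding N_def by force
      ultimately show "(colour(A := c)) B \<noteq> (colour(A := c)) B'"
        using B st c(2) by (auto simp: state_def)
    qed
    show "disjoint (insert A P)"
      using st A(1) \<open>A \<notin> P\<close> by (auto simp: state_def disjoint_def)
  qed (use st A c \<open>A \<notin> P\<close> in \<open>auto simp: state_def\<close>)
  then show ?thesis by blast
qed

lemma state_fill:
  assumes "state F P colour par S"
  shows "\<exists>P' colour'. state F P' colour' par S \<and> card (F - \<Union>P') < r"
  using assms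
proof (induction "card (F - \<Union>P)" arbitrary: P colour rule: less_induct)
  case less
  show ?case
  proof (cases "card (F - \<Union>P) < r")
    case False
    then obtain A where A: "A \<subseteq> F - \<Union>P" "card A = r"
      using obtain_subset_with_card_n by (metis linorder_not_less)
    obtain colour' where st': "state F (insert A P) colour' par S"
      using state_add_block[OF less.prems A] by blast
    have "finite F" using state_finite[OF less.prems] .
    moreover have "A \<noteq> {}" using A r_pos by auto
    ultimately have "card (F - \<Union>(insert A P)) < card (F - \<Union>P)"
      using A by (intro psubset_card_mono) auto
    then show ?thesis using less.hyps st' by blast
  qed (use less.prems in blast)
qed

text \<open>The case in which every block meets \<open>span S\<close> in dimension at least
  \<open>a\<close>: the \<open>K A\<close> turn out to form a direct sum. Different colours use
  different points outside \<open>F\<close>, so their vertices \<open>w A\<close> are disjoint.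
  Blocks of one colour share such a point, and it is the colour condition on parents that separates
  them.\<close>

lemma state_blocks_bound:
  assumes st: "state F P colour par S"
    and \<zeta>: "inj_on \<zeta> {..r}" "\<zeta> ` {..r} \<subseteq> X - F"
    and K: "\<And>A. A \<in> P \<Longrightarrow> K A \<subseteq> U (insert (\<zeta> (colour A)) A) \<inter> span S"
      "\<And>A. A \<in> P \<Longrightarrow> independent (K A)" "\<And>A. A \<in> P \<Longrightarrow> card (K A) = a"
  shows "a * card P \<le> card S"
proof -
  note st' = st[unfolded state_def]
  have F: "F \<subseteq> X" and S: "finite S" using st' by simp_all
  have P: "A \<subseteq> F" "card A = r" "colour A \<le> r" if "A \<in> P" for A using st' that by simp_all
  have disj: "A \<inter> B = {}" if "A \<in> P" "B \<in> P" "A \<noteq> B" for A B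
    using st' that by (simp add: disjoint_def)
  have proper: "colour A \<noteq> colour B" if "A \<in> P" "y \<in> A" "par y = Some B" for A y B
    using st' that by metis
  define w where "w A = insert (\<zeta> (colour A)) A" for A
  have finP: "finite P"
    by (rule finite_subset[of _ "Pow F"]) (use P(1) state_finite[OF st] in auto)
  have \<zeta>_out: "\<zeta> (colour A) \<in> X" "\<zeta> (colour A) \<notin> F" if "A \<in> P" for A
    using \<zeta>(2) P(3)[OF that] by auto
  have w: "w A \<subseteq> X" "card (w A) = Suc r" if "A \<in> P" for A
    using vertex_insert[OF st that, of "\<zeta> (colour A)"] \<zeta>_out[OF that] P(1)[OF that] by (auto simp: w_def)
  \<comment> \<open>Needed because anisotropy is available on \<open>C\<close> only.\<close>
  have S_C: "span S \<subseteq> C"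
  proof (rule span_minimal[OF _ subspace_C], rule subsetI)
    fix v assume "v \<in> S"
    then obtain y A where yA: "par y = Some A" "v \<in> U (insert y A)" by (rule state_generated[OF st])
    then show "v \<in> C"
      using U_subset_C[OF vertex_insert[OF st, of A y]] state_par[OF st yA(1)] F by blast
  qed
  show ?thesis
  proof (rule independent_family_card_le[OF finP S])
    fix A assume "A \<in> P"
    then show "K A \<subseteq> span S" "independent (K A)" "card (K A) = a" using K by auto
  next
    fix x A assume xK: "\<And>B. B \<in> P \<Longrightarrow> x B \<in> span (K B)" and x0: "sum x P = 0" and A: "A \<in> P"
    have xU: "x B \<in> U (w B)" if "B \<in> P" for B
      using span_minimal[OF _ subspace_U[OF w[OF that]], of "K B"] K(1)[OF that] xK[OF that]
      by (auto simp: w_def)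
    have xS: "x B \<in> span S" if "B \<in> P" for B
      using span_minimal[OF _ subspace_span, of "K B" S] K(1)[OF that] xK[OF that] by auto
    have diff_col: "ip (x B) (x B') = 0" if B: "B \<in> P" "B' \<in> P" "colour B \<noteq> colour B'" for B B'
    proof (rule orth_U[OF w[OF B(1)] w[OF B(2)] _ xU[OF B(1)] xU[OF B(2)]])
      have "\<zeta> (colour B) \<noteq> \<zeta> (colour B')"
        using \<zeta>(1) B P(3) by (auto dest: inj_onD)
      moreover have "B \<inter> B' = {}" using disj B by metis
      ultimately show "w B \<inter> w B' = {}"
        using \<zeta>_out[OF B(1)] \<zeta>_out[OF B(2)] P(1)[OF B(1)] P(1)[OF B(2)] by (auto simp: w_def)
    qed
    \<comment> \<open>Summands of different colours are orthogonal, so the relation splits into one relation per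
      colour. Within one colour a generator of the span of \<open>S\<close> meets at most one block, and \<open>x A\<close> is
      minus the sum of the others; hence \<open>x A\<close> is orthogonal to every generator.\<close>
    define Q where "Q = {B \<in> P. colour B = colour A}"
    have "ip (x B) (sum x P) = ip (x B) (sum x Q)" if "B \<in> Q" for B
      unfolding ip_sum_right using finP that
      by (intro sum.mono_neutral_right) (auto simp: Q_def intro!: diff_col)
    then have "ip (sum x Q) (sum x Q) = 0"
      using x0 by (simp add: ip_sum_left[of x Q "sum x Q"] ip_commute[of _ 0])
    moreover have "sum x Q \<in> C"
      using xS S_C by (intro subspace_sum[OF subspace_C]) (auto simp: Q_def)
    ultimately have Q0: "sum x Q = 0" by (rule anisotropic[rotated])
    have "ip (x A) v = 0" if "v \<in> S" for v
    proof -
      obtain y B where yB: "par y = Some B" and v: "v \<in> U (insert y B)"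
        using \<open>v \<in> S\<close> by (rule state_generated[OF st])
      have B: "y \<in> F" "B \<in> P" "y \<notin> B" using state_par[OF st yB] by auto
      have vert: "insert y B \<subseteq> X" "card (insert y B) = Suc r"
        using vertex_insert[OF st B(2) _ B(3)] B(1) F by auto
      have orth: "ip (x D) v = 0" if D: "D \<in> P" "D \<inter> insert y B = {}" for D
      proof (rule orth_U[OF w[OF D(1)] vert _ xU[OF D(1)] v])
        show "w D \<inter> insert y B = {}"
          using D(2) \<zeta>_out[OF D(1)] B P(1)[OF B(2)] by (auto simp: w_def)
      qed
      show ?thesis
      proof (cases "A \<inter> insert y B = {}")
        case False
        \<comment> \<open>The colour condition says that a block containing \<open>y\<close> differs
          in colour from \<open>B\<close>. If \<open>A = B\<close>, then \<open>D\<close> has the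
          colour of \<open>B\<close> and so misses \<open>y\<close>; if \<open>y \<in> A\<close>,
          then \<open>D\<close> has the colour of \<open>A\<close> and so is not \<open>B\<close>.
          Disjointness of blocks does the rest.\<close>
        have "D \<inter> insert y B = {}" if D: "D \<in> Q - {A}" for D
        proof -
          have D': "D \<in> P" "colour D = colour A" "D \<noteq> A" using D by (auto simp: Q_def)
          have "D \<inter> A = {}" using disj D' A by blast
          moreover have "A = B \<or> y \<in> A" using False disj[OF A B(2)] by auto
          moreover have "y \<notin> D" if "A = B" using proper[OF D'(1) _ yB] D'(2) that by auto
          moreover have "D \<noteq> B" if "y \<in> A" using proper[OF A that yB] D'(2) by auto
          ultimately show ?thesis using disj[OF D'(1) B(2)] by auto
        qed
        then have "(\<Sum>D\<in>Q - {A}. ip (x D) v) = 0"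
          using orth by (intro sum.neutral) (auto simp: Q_def)
        moreover have "ip (sum x Q) v = ip (x A) v + (\<Sum>D\<in>Q - {A}. ip (x D) v)"
          unfolding ip_sum_left using finP A by (intro sum.remove) (auto simp: Q_def)
        ultimately show ?thesis using Q0 by simp
      qed (use orth A in blast)
    qed
    then have "ip (x A) (x A) = 0" using xS[OF A] by (rule orthogonal_span_right)
    then show "x A = 0" using anisotropic xS[OF A] S_C by blast
  qed
qed

text \<open>Either way the invariant pays for one more point. A gain of \<open>q\<close> dimensions
  raises the right side by \<open>r * q\<close>, which is at least \<open>a\<close>; without such a
  gain, \<open>state_blocks_bound\<close> yields the inequality afresh. The assumption
  \<open>room\<close> supplies one outside point for each of the \<open>r + 1\<close>
  colours.\<close>

lemma state_step:
  assumes st0: "state F P\<^sub>0 colour\<^sub>0 par S" and room: "Suc r \<le> card (X - F)"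
  shows "\<exists>z P colour par S. z \<in> X - F \<and> state (insert z F) P colour par S"
proof -
  obtain P colour where st: "state F P colour par S" and full: "card (F - \<Union>P) < r"
    using state_fill[OF st0] by blast
  have finF: "finite F" using st by (rule state_finite)
  have PF: "\<And>A. A \<in> P \<Longrightarrow> A \<subseteq> F" using st by (auto simp: state_def)
  have FX: "F \<subseteq> X" using st by (auto simp: state_def)
  have dich: "(\<exists>D \<subseteq> U (insert z A). finite D \<and> D \<inter> S = {} \<and> independent (S \<union> D) \<and> card D = q) \<or>
      (\<exists>D \<subseteq> U (insert z A) \<inter> span S. independent D \<and> card D = a)"
    if "z \<in> X - F" "A \<in> P" for z A
  proof -
    have "z \<notin> A" using that PF by blast
    then have vert: "insert z A \<subseteq> X" "card (insert z A) = Suc r"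
      using vertex_insert[OF st that(2), of z] that(1) by simp_all
    have S: "finite S" "independent S" using st by (simp_all add: state_def)
    obtain B where B: "B \<subseteq> U (insert z A)" "finite B" "independent B" "a + q \<le> card B + 1"
      using dim_U[OF vert] by blast
    obtain T where T: "finite T" "U (insert z A) \<subseteq> span T"
      using fin_dim_U[OF vert] by blast
    show ?thesis
    proof (rule extend_independent_or_meet_span[OF S subspace_U[OF vert] B(1,3,2) T(2,1) B(4)])
      fix D
      assume "D \<subseteq> U (insert z A)" "finite D" "D \<inter> S = {}" "independent (S \<union> D)" "card D = q"
      then show ?thesis by (intro disjI1 exI[of _ D] conjI)
    next
      fix D
      assume "D \<subseteq> U (insert z A) \<inter> span S" "finite D" "independent D" "card D = a"
      then show ?thesis by (intro disjI2 exI[of _ D] conjI)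
    qed
  qed
  show ?thesis
  proof (cases "\<exists>z\<in>X - F. \<exists>A\<in>P. \<exists>D\<subseteq>U (insert z A).
      finite D \<and> D \<inter> S = {} \<and> independent (S \<union> D) \<and> card D = q")
    case True
    then obtain z A D where zA: "z \<in> X" "z \<notin> F" "A \<in> P"
      and D: "D \<subseteq> U (insert z A)" "finite D" "D \<inter> S = {}" "independent (S \<union> D)" "card D = q"
      by blast
    have "state (insert z F) P colour (par(z := Some A)) (S \<union> D)"
      unfolding state_def
    proof (intro conjI)
      have "card (S \<union> D) = card S + q"
        using st D by (subst card_Un_disjoint) (auto simp: state_def)
      then show "a * card (insert z F) \<le> r * card (S \<union> D) + a * r"
        using st zA finF a_le by (auto simp: state_def algebra_simps)
      show "\<forall>v\<in>S \<union> D. \<exists>y B. (par(z := Some A)) y = Some B \<and> v \<in> U (insert y B)"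
      proof
        fix v assume v: "v \<in> S \<union> D"
        show "\<exists>y B. (par(z := Some A)) y = Some B \<and> v \<in> U (insert y B)"
        proof (cases "v \<in> D")
          case False
          then have "v \<in> S" using v by blast
          then obtain y B where yB: "par y = Some B" "v \<in> U (insert y B)"
            by (rule state_generated[OF st])
          then have "y \<noteq> z" using state_par(1)[OF st] zA(2) by blast
          then show ?thesis using yB by (intro exI[of _ y] exI[of _ B]) auto
        qed (use D in \<open>intro exI[of _ z] exI[of _ A], auto\<close>)
      qed
      \<comment> \<open>Blocks lie in \<open>F\<close>, so none contains \<open>z\<close>: its new
        parent restricts no colour until \<open>z\<close> itself enters a block.\<close>
      show "\<forall>B\<in>P. \<forall>y\<in>B. \<forall>B'. (par(z := Some A)) y = Some B' \<longrightarrow> colour B \<noteq> colour B'"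
      proof (intro ballI allI impI)
        fix B y B' assume B: "B \<in> P" "y \<in> B" "(par(z := Some A)) y = Some B'"
        then have "par y = Some B'" using PF zA(2) by (auto split: if_splits)
        then show "colour B \<noteq> colour B'" using st B(1,2) unfolding state_def by metis
      qed
      show "\<forall>y B. (par(z := Some A)) y = Some B \<longrightarrow> y \<in> insert z F \<and> B \<in> P \<and> y \<notin> B"
      proof (intro allI impI)
        fix y B assume B: "(par(z := Some A)) y = Some B"
        show "y \<in> insert z F \<and> B \<in> P \<and> y \<notin> B"
        proof (cases "y = z")
          case True
          then have "B = A" using B by simp
          then show ?thesis using True zA PF[OF zA(3)] by blast
        next
          case False
          then have "par y = Some B" using B by simp
          then show ?thesis using state_par[OF st, of y B] by simp
        qed
      qed
      show "insert z F \<subseteq> X" using FX zA(1) by blast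
      have "card B = r" "colour B \<le> r" if "B \<in> P" for B
        using st that by (simp_all add: state_def)
      then show "\<forall>B\<in>P. B \<subseteq> insert z F \<and> card B = r \<and> colour B \<le> r"
        using PF by blast
      show "disjoint P" using st by (simp only: state_def)
      show "finite (S \<union> D)" using st D(2) by (simp add: state_def)
    qed (rule D(4))
    then show ?thesis using zA(1,2) by (intro exI conjI) (rule DiffI)
  next
    case False
    then have "\<forall>z\<in>X - F. \<forall>A\<in>P. \<exists>D \<subseteq> U (insert z A) \<inter> span S. independent D \<and> card D = a"
      using dich by meson
    then obtain K where K: "\<forall>z\<in>X - F. \<forall>A\<in>P.
        K z A \<subseteq> U (insert z A) \<inter> span S \<and> independent (K z A) \<and> card (K z A) = a"
      unfolding bchoice_iff by blast
    obtain \<zeta> where \<zeta>: "inj_on \<zeta> {..r}" "\<zeta> ` {..r} \<subseteq> X - F"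
      using card_le_inj[of "{..r}" "X - F"] finite_X room by auto
    have colour: "\<zeta> (colour A) \<in> X - F" if "A \<in> P" for A
      using \<zeta>(2) st that by (auto simp: state_def)
    have "a * card P \<le> card S"
      using K colour by (intro state_blocks_bound[OF st \<zeta>, where K = "\<lambda>A. K (\<zeta> (colour A)) A"]) blast+
    moreover have "card F \<le> card P * r + card (F - \<Union>P)"
    proof -
      have "card (\<Union>P) \<le> card P * r"
      proof -
        have "card (\<Union>P) \<le> (\<Sum>A\<in>P. card A)"
          by (rule card_Union_le_sum_card)
        also have "\<dots> = card P * r" using st by (simp add: state_def)
        finally show ?thesis .
      qed
      moreover have "card F \<le> card (\<Union>P) + card (F - \<Union>P)"
      proof -
        have "finite (\<Union>P)" using PF finF by (meson Sup_least finite_subset)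
        then have "card F \<le> card (\<Union>P \<union> (F - \<Union>P))"
          using finF by (intro card_mono) auto
        also have "\<dots> \<le> card (\<Union>P) + card (F - \<Union>P)" by (rule card_Un_le)
        finally show ?thesis .
      qed
      ultimately show ?thesis by simp
    qed
    ultimately have bound: "a * Suc (card F) \<le> r * card S + a * r"
    proof -
      assume P: "a * card P \<le> card S" and F: "card F \<le> card P * r + card (F - \<Union>P)"
      \<comment> \<open>Strictly fewer than \<open>r\<close> points of \<open>F\<close> lie outside
        the blocks, which leaves space for the new point within the additive
        \<open>a * r\<close>.\<close>
      have "a * Suc (card F) \<le> a * (card P * r + r)"
        using F full by (intro mult_le_mono2) linarith
      also have "\<dots> = r * (a * card P) + a * r" by (simp add: algebra_simps)
      also have "\<dots> \<le> r * card S + a * r" using P by (intro add_mono mult_le_mono2) auto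
      finally show ?thesis .
    qed
    have "X - F \<noteq> {}" using room by (metis card.empty not_less_eq_eq zero_le)
    then obtain z where z: "z \<in> X - F" by blast
    have "state (insert z F) P colour par S"
      using st z bound finF by (auto simp: state_def)
    then show ?thesis using z by blast
  qed
qed

text \<open>Steps are possible while more than \<open>r\<close> points remain outside
  \<open>F\<close>. The last \<open>r\<close> points cost \<open>a * r\<close>, on top of the
  \<open>a * r\<close> in the invariant.\<close>

theorem independent_set_exists:
  "\<exists>S. S \<subseteq> C \<and> independent S \<and> a * card X \<le> r * card S + 2 * a * r"
proof -
  \<comment> \<open>Truncated subtraction covers \<open>card X < r\<close>, where \<open>F\<close>
    stays empty.\<close>
  have "\<exists>F P colour par S. state F P colour par S \<and> card F = n" if "n \<le> card X - r" for n
    using that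
  proof (induction n)
    case 0
    have "state {} {} (\<lambda>_. 0) (\<lambda>_. None) {}"
      by (simp add: state_def independent_empty)
    then show ?case by fastforce
  next
    case (Suc n)
    then obtain F P colour par S where st: "state F P colour par S" and n: "card F = n" by auto
    have FX: "F \<subseteq> X" using st by (simp add: state_def)
    have finF: "finite F" using st by (rule state_finite)
    have "Suc r \<le> card (X - F)"
      using Suc.prems n card_Diff_subset[OF finF FX] by simp
    then obtain z P colour par S where "z \<in> X - F" "state (insert z F) P colour par S"
      using state_step[OF st] by blast
    then show ?case using n finF by (metis DiffD2 card_insert_disjoint)
  qed
  then obtain F P colour par S where st: "state F P colour par S" and n: "card F = card X - r" by blast
  have "S \<subseteq> C"
  proof
    fix v assume "v \<in> S"
    then obtain y A where yA: "par y = Some A" "v \<in> U (insert y A)" by (rule state_generated[OF st])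
    have "F \<subseteq> X" using st by (simp add: state_def)
    then show "v \<in> C"
      using U_subset_C[OF vertex_insert[OF st, of A y]] state_par[OF st yA(1)] yA(2) by blast
  qed
  moreover have "a * card X \<le> r * card S + 2 * a * r"
  proof -
    have "a * card X \<le> a * (card F + r)" using n by (intro mult_le_mono2) simp
    also have "\<dots> \<le> r * card S + 2 * a * r" using st by (simp add: state_def algebra_simps)
    finally show ?thesis .
  qed
  moreover have "independent S" using st by (simp add: state_def)
  ultimately show ?thesis by blast
qed

end

section \<open>Passing from vectors to functions on the naturals\<close>

interpretation real_fun: vector_space "\<lambda>(c::real) f (i::nat). c * f i"
  by unfold_locales (auto simp: algebra_simps fun_eq_iff)

lemma sum_fun_apply: "sum f A x = (\<Sum>a\<in>A. f a x)"
  for f :: "'b \<Rightarrow> 'c \<Rightarrow> 'd::comm_monoid_add"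
  by (induction A rule: infinite_finite_induct) simp_all

text \<open>The type \<open>real vec\<close> mixes all dimensions and is not one vector space.
  Padding with zeros embeds every \<open>carrier_vec t\<close> into a type that is.\<close>

definition fun_of_vec :: "real vec \<Rightarrow> nat \<Rightarrow> real" where
  "fun_of_vec v i = (if i < dim_vec v then v $ i else 0)"

definition dot_upto :: "nat \<Rightarrow> (nat \<Rightarrow> real) \<Rightarrow> (nat \<Rightarrow> real) \<Rightarrow> real" where
  "dot_upto t f g = (\<Sum>i<t. f i * g i)"

definition supported_below :: "nat \<Rightarrow> (nat \<Rightarrow> real) set" where
  "supported_below t = {f. \<forall>i\<ge>t. f i = 0}"

lemma anisotropic_supported_below:
  "anisotropic_space (\<lambda>(c::real) f (i::nat). c * f i) (dot_upto t) (supported_below t)"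
proof unfold_locales
  show "real_fun.subspace (supported_below t)"
    by (simp add: real_fun.subspace_def supported_below_def)
next
  fix f assume f: "f \<in> supported_below t" and "dot_upto t f f = 0"
  then have "\<forall>i<t. f i * f i = 0"
    unfolding dot_upto_def by (subst (asm) sum_nonneg_eq_0_iff) auto
  show "f = 0"
  proof
    fix i show "f i = 0 i"
      using f \<open>\<forall>i<t. f i * f i = 0\<close> by (cases "i < t") (auto simp: supported_below_def)
  qed
qed (auto simp: dot_upto_def sum.distrib sum_distrib_left algebra_simps)

lemma supported_below_subset_span:
  obtains T :: "(nat \<Rightarrow> real) set"
  where "finite T" "card T \<le> t" "supported_below t \<subseteq> real_fun.span T"
proof
  let ?T = "(\<lambda>j i. if i = j then 1 else 0 :: real) ` {..<t}"
  show "finite ?T" by simp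
  show "card ?T \<le> t" using card_image_le[of "{..<t}"] by simp
  show "supported_below t \<subseteq> real_fun.span ?T"
  proof
    fix f assume "f \<in> supported_below t"
    then have "f = (\<Sum>j<t. (\<lambda>i. f j * (if i = j then 1 else 0)))"
      by (auto simp: fun_eq_iff supported_below_def sum_fun_apply if_distrib cong: if_cong)
    also have "\<dots> \<in> real_fun.span ?T"
      by (intro real_fun.span_sum real_fun.span_scale real_fun.span_base) auto
    finally show "f \<in> real_fun.span ?T" .
  qed
qed

lemma fun_of_vec_add:
  assumes "v \<in> carrier_vec t" "w \<in> carrier_vec t"
  shows "fun_of_vec (v + w) = fun_of_vec v + fun_of_vec w"
  using assms by (auto simp: fun_of_vec_def fun_eq_iff)

lemma fun_of_vec_smult: "fun_of_vec (c \<cdot>\<^sub>v v) = (\<lambda>i. c * fun_of_vec v i)"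
  by (auto simp: fun_of_vec_def fun_eq_iff)

lemma real_subspaceD:
  assumes "real_subspace t W"
  shows "W \<subseteq> carrier_vec t" "0\<^sub>v t \<in> W" "v \<in> W \<Longrightarrow> w \<in> W \<Longrightarrow> v + w \<in> W" "v \<in> W \<Longrightarrow> c \<cdot>\<^sub>v v \<in> W"
  using assms unfolding real_subspace_def VectorSpace.subspace_def submodule_def
  by (auto simp: module_vec_def)

lemma subspace_fun_of_vec:
  assumes "real_subspace t W"
  shows "real_fun.subspace (fun_of_vec ` W)" "fun_of_vec ` W \<subseteq> supported_below t"
proof -
  note W = real_subspaceD[OF assms]
  show "real_fun.subspace (fun_of_vec ` W)"
  proof (rule real_fun.subspaceI)
    have "fun_of_vec (0\<^sub>v t) = 0" by (simp add: fun_of_vec_def fun_eq_iff)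
    then show "0 \<in> fun_of_vec ` W" using W(2) by (metis imageI)
  next
    fix x y assume "x \<in> fun_of_vec ` W" "y \<in> fun_of_vec ` W"
    then obtain v w where vw: "v \<in> W" "w \<in> W" "x = fun_of_vec v" "y = fun_of_vec w" by blast
    then have "x + y = fun_of_vec (v + w)" using W(1) by (auto intro!: fun_of_vec_add[symmetric])
    then show "x + y \<in> fun_of_vec ` W" using W(3)[OF vw(1,2)] by blast
  next
    fix c x assume "x \<in> fun_of_vec ` W"
    then obtain v where v: "v \<in> W" "x = fun_of_vec v" by blast
    then have "(\<lambda>i. c * x i) = fun_of_vec (c \<cdot>\<^sub>v v)" by (simp add: fun_of_vec_smult)
    then show "(\<lambda>i. c * x i) \<in> fun_of_vec ` W" using W(4)[OF v(1)] by blast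
  qed
  show "fun_of_vec ` W \<subseteq> supported_below t"
    using W(1) by (auto simp: supported_below_def fun_of_vec_def)
qed

text \<open>
  The dimension of \<open>W\<close> is defined as the least size of a generating set, so a basis of the image,
  pulled back to \<open>W\<close>, bounds it without any dimension theory on the side of \<open>vec\<close>.
\<close>

lemma independent_fun_of_vec_exists:
  assumes "real_subspace t W"
  obtains B where "B \<subseteq> fun_of_vec ` W" "finite B" "real_fun.independent B"
    "real_subspace_dim t W \<le> card B"
proof -
  interpret V: vec_space "TYPE(real)" t .
  note W = real_subspaceD[OF assms]
  obtain B where B: "B \<subseteq> fun_of_vec ` W" "real_fun.independent B" "fun_of_vec ` W \<subseteq> real_fun.span B"
    using real_fun.maximal_independent_subset by blast
  obtain T :: "(nat \<Rightarrow> real) set" where "finite T" "supported_below t \<subseteq> real_fun.span T"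
    using supported_below_subset_span by blast
  then have "finite B"
    using real_fun.independent_span_bound[OF _ B(2)] B(1) subspace_fun_of_vec(2)[OF assms] by blast
  define g where "g = inv_into W fun_of_vec"
  have g: "g b \<in> W" "fun_of_vec (g b) = b" if "b \<in> B" for b
    using that B(1) by (auto simp: g_def inv_into_into f_inv_into_f)
  have inj: "inj_on g B" using g(2) by (metis inj_onI)
  have sub: "submodule class_ring W (module_vec TYPE(real) t)"
    using assms unfolding real_subspace_def VectorSpace.subspace_def by blast
  have gB: "g ` B \<subseteq> carrier_vec t" using g(1) W(1) by blast
  have "V.span (g ` B) = W"
  proof
    show "V.span (g ` B) \<subseteq> W"
      using g(1) by (intro V.span_is_subset sub) auto
    show "W \<subseteq> V.span (g ` B)"
    proof
      fix x assume x: "x \<in> W"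
      then have xc: "x \<in> carrier_vec t" using W(1) by blast
      have "fun_of_vec x \<in> real_fun.span B" using x B(3) by blast
      then obtain u where u: "fun_of_vec x = (\<Sum>b\<in>B. (\<lambda>i. u b * b i))"
        unfolding real_fun.span_finite[OF \<open>finite B\<close>] by blast
      \<comment> \<open>Coefficients in \<open>lincomb\<close> are indexed by vectors; that of
        \<open>g b\<close> is \<open>u (fun_of_vec (g b)) = u b\<close>.\<close>
      have "x = V.lincomb (u \<circ> fun_of_vec) (g ` B)"
      proof (rule eq_vecI)
        show dim: "dim_vec x = dim_vec (V.lincomb (u \<circ> fun_of_vec) (g ` B))"
          using xc V.lincomb_dim[OF _ gB] \<open>finite B\<close> by simp
        fix i assume "i < dim_vec (V.lincomb (u \<circ> fun_of_vec) (g ` B))"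
        then have i: "i < t" using dim xc by simp
        have "V.lincomb (u \<circ> fun_of_vec) (g ` B) $ i = (\<Sum>b\<in>B. u b * g b $ i)"
          by (simp add: V.lincomb_index[OF i gB] sum.reindex[OF inj] g(2))
        also have "\<dots> = (\<Sum>b\<in>B. u b * b i)"
        proof (intro sum.cong refl)
          fix b assume b: "b \<in> B"
          have "g b \<in> carrier_vec t" using gB b by blast
          then have "fun_of_vec (g b) i = g b $ i" using i by (simp add: fun_of_vec_def)
          then show "u b * g b $ i = u b * b i" using g(2)[OF b] by simp
        qed
        also have "\<dots> = fun_of_vec x i" by (simp add: u sum_fun_apply)
        also have "\<dots> = x $ i" using i xc by (simp add: fun_of_vec_def)
        finally show "x $ i = V.lincomb (u \<circ> fun_of_vec) (g ` B) $ i" by simp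
      qed
      then show "x \<in> V.span (g ` B)"
        using \<open>finite B\<close> unfolding V.span_def by (auto simp: class_ring_simps)
    qed
  qed
  \<comment> \<open>The dimension of \<open>W\<close> refers to spans taken inside the restricted
    carrier, which agree with spans in the whole space because \<open>W\<close> is a
    submodule.\<close>
  then have gen: "LinearCombinations.module.span class_ring (V.md W) (g ` B) = W"
    using V.span_li_not_depend(1)[OF _ sub, of "g ` B"] g(1) by auto
  have "vectorspace class_ring (V.vs W)"
    using assms V.subspace_is_vs unfolding real_subspace_def by blast
  then have "real_subspace_dim t W \<le> card (g ` B)"
    unfolding real_subspace_dim_def
    by (subst vectorspace.dim_def) (use gen g(1) \<open>finite B\<close> in \<open>auto intro!: Least_le\<close>)
  then show thesis
    using that[OF B(1) \<open>finite B\<close> B(2)] card_image_le[OF \<open>finite B\<close>, of g] by linarith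
qed

lemma dot_upto_fun_of_vec:
  assumes "v \<in> carrier_vec t" "w \<in> carrier_vec t"
  shows "dot_upto t (fun_of_vec v) (fun_of_vec w) = v \<bullet> w"
  using assms by (auto simp: dot_upto_def fun_of_vec_def scalar_prod_def atLeast0LessThan)

lemma kneser_rep_of_orthogonal_subspace_rep:
  assumes U: "orthogonal_subspace_rep t k (kneser_graph d (Suc r)) U"
    and "r > 0" "a + q = k + 1" "a \<le> r * q"
  shows "kneser_rep (\<lambda>(c::real) f (i::nat). c * f i) (dot_upto t) (supported_below t)
    {1..d} (\<lambda>A. fun_of_vec ` U A) r a q"
proof -
  interpret anisotropic_space "\<lambda>(c::real) f (i::nat). c * f i" "dot_upto t" "supported_below t"
    by (rule anisotropic_supported_below)
  have sub: "real_subspace t (U A)" and dim: "real_subspace_dim t (U A) = k"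
    if "A \<subseteq> {1..d}" "card A = Suc r" for A
    using U that by (auto simp: orthogonal_subspace_rep_def kneser_graph_def)
  show ?thesis
  proof unfold_locales
    fix A :: "nat set" assume A: "A \<subseteq> {1..d}" "card A = Suc r"
    show "real_fun.subspace (fun_of_vec ` U A)" and C: "fun_of_vec ` U A \<subseteq> supported_below t"
      by (rule subspace_fun_of_vec[OF sub[OF A]])+
    show "\<exists>T. finite T \<and> fun_of_vec ` U A \<subseteq> real_fun.span T"
    proof -
      obtain T :: "(nat \<Rightarrow> real) set" where "finite T" "supported_below t \<subseteq> real_fun.span T"
        using supported_below_subset_span by blast
      then show ?thesis using C by (intro exI[of _ T] conjI) auto
    qed
    show "\<exists>B\<subseteq>fun_of_vec ` U A. finite B \<and> real_fun.independent B \<and> a + q \<le> card B + 1"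
    proof -
      obtain B where "B \<subseteq> fun_of_vec ` U A" "finite B" "real_fun.independent B"
          "real_subspace_dim t (U A) \<le> card B"
        by (rule independent_fun_of_vec_exists[OF sub[OF A]])
      then show ?thesis using dim[OF A] assms(3) by (intro exI[of _ B] conjI) auto
    qed
    fix B :: "nat set" and x y assume B: "B \<subseteq> {1..d}" "card B = Suc r" and disj: "A \<inter> B = {}"
      and xy: "x \<in> fun_of_vec ` U A" "y \<in> fun_of_vec ` U B"
    have "orthogonal_subspaces (U A) (U B)"
      using U A B disj by (simp add: orthogonal_subspace_rep_def kneser_graph_def)
    moreover obtain v w where vw: "v \<in> U A" "w \<in> U B" "x = fun_of_vec v" "y = fun_of_vec w"
      using xy by blast
    moreover have "v \<in> carrier_vec t" "w \<in> carrier_vec t"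
      using real_subspaceD(1)[OF sub[OF A]] real_subspaceD(1)[OF sub[OF B]] vw by blast+
    ultimately show "dot_upto t x y = 0"
      by (simp add: orthogonal_subspaces_def dot_upto_fun_of_vec)
  qed (use assms in auto)
qed

section \<open>The lower bound for Kneser graphs\<close>

lemma orth_dim_kneser_graph_lower:
  assumes "r > 0" "a + q = k + 1" "a \<le> r * q"
  shows "a * d \<le> r * orth_dim k (kneser_graph d (Suc r)) + 2 * a * r"
proof -
  let ?t = "orth_dim k (kneser_graph d (Suc r))"
  \<comment> \<open>The \<open>LEAST\<close> in \<open>orth_dim\<close> is attained because some
    representation exists.\<close>
  have "\<exists>U. orthogonal_subspace_rep ?t k (kneser_graph d (Suc r)) U"
    unfolding orth_dim_def
    using orthogonal_subspace_rep_exists[OF pair_graph_kneser_graph[of "Suc r" d]] by (auto intro: LeastI_ex)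
  then obtain U where U: "orthogonal_subspace_rep ?t k (kneser_graph d (Suc r)) U" by blast
  interpret kneser_rep "\<lambda>(c::real) f (i::nat). c * f i" "dot_upto ?t" "supported_below ?t"
    "{1..d}" "\<lambda>A. fun_of_vec ` U A" r a q
    using kneser_rep_of_orthogonal_subspace_rep[OF U assms] .
  obtain S where S: "S \<subseteq> supported_below ?t" "real_fun.independent S"
      "a * card {1..d} \<le> r * card S + 2 * a * r"
    using independent_set_exists by blast
  obtain T :: "(nat \<Rightarrow> real) set"
    where T: "finite T" "card T \<le> ?t" "supported_below ?t \<subseteq> real_fun.span T"
    using supported_below_subset_span by blast
  have "card S \<le> ?t"
    using real_fun.independent_span_bound[OF T(1) S(2)] S(1) T(2,3) by force
  then have "r * card S \<le> r * ?t" by (rule mult_le_mono2)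
  moreover have "a * d \<le> r * card S + 2 * a * r" using S(3) by simp
  ultimately show ?thesis by linarith
qed

theorem theorem1p7:
  fixes k s :: nat
  assumes "k \<ge> s" and "s \<ge> 3"
  shows "\<exists>c :: real. \<forall>d :: nat. d \<ge> 2 * s \<longrightarrow>
    real (orth_dim k (kneser_graph d s)) \<ge>
      (real k - real_of_int \<lceil>(real k + 1) / real s\<rceil> + 1) / (real s - 1) * real d - c"
proof -
  define r where "r = s - 1"
  have r: "s = Suc r" "r > 0" using assms by (auto simp: r_def)
  \<comment> \<open>With \<open>a = k + 1 - q\<close> and \<open>r = s - 1\<close>, the condition
    \<open>a \<le> r * q\<close> amounts to \<open>k + 1 \<le> s * q\<close>. The ceiling is the
    least such \<open>q\<close>, hence gives the largest slope \<open>a / r\<close>.\<close>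
  define q where "q = nat \<lceil>(real k + 1) / real s\<rceil>"
  have "0 \<le> (real k + 1) / real s" by simp
  then have q: "real_of_int \<lceil>(real k + 1) / real s\<rceil> = real q"
    unfolding q_def by linarith
  \<comment> \<open>This leads to \<open>q \<le> k + 1\<close>, so the natural subtraction defining
    \<open>a\<close> is exact.\<close>
  have "(real k + 1) / real s \<le> real_of_int (int k + 1)" using r by (simp add: divide_le_eq)
  then have "\<lceil>(real k + 1) / real s\<rceil> \<le> int k + 1" by (rule ceiling_le)
  then have "q \<le> k + 1" unfolding q_def by linarith
  define a where "a = k + 1 - q"
  have aq: "a + q = k + 1" using \<open>q \<le> k + 1\<close> by (simp add: a_def)
  have "(real k + 1) / real s \<le> real q" using q by linarith
  then have "real k + 1 \<le> real q * real s" using r by (simp add: divide_le_eq)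
  then have "real (k + 1) \<le> real (q * s)" by simp
  then have "k + 1 \<le> q * s" by (simp only: of_nat_le_iff)
  then have "a \<le> r * q" using aq r by (simp add: algebra_simps)
  note bound = orth_dim_kneser_graph_lower[OF r(2) aq this]
  have num: "real k - real q + 1 = real a" using aq by linarith
  show ?thesis
  \<comment> \<open>The constant is the error term \<open>2 * a * r\<close> divided by
    \<open>r\<close>.\<close>
  proof (intro exI[of _ "2 * real a"] allI impI)
    fix d :: nat
    have "real (a * d) \<le> real (r * orth_dim k (kneser_graph d s) + 2 * a * r)"
      using bound[of d] r(1) by (simp only: of_nat_le_iff)
    then show "real (orth_dim k (kneser_graph d s)) \<ge>
      (real k - real_of_int \<lceil>(real k + 1) / real s\<rceil> + 1) / (real s - 1) * real d - 2 * real a"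
      using r(2) unfolding q num by (simp add: r(1) field_simps)
  qed
qed

end
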